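(* For every $n\ge 3$, $L_n[2]=PL_n$.
   Context: The triplet group is $L_n=\langle y_1,\dots,y_{n-1}\mid y_j^2=1 \text{ for } 1\le j\le n-1,\ y_iy_{i+1}y_i=y_{i+1}y_iy_{i+1} \text{ for } 1\le i\le n-2\rangle$. The pure triplet group $PL_n$ is the kernel of the surjection $L_n\to S_n$ sending $y_i$ to the transposition $\tau_i=(i,i+1)$ of the symmetric group $S_n$. The Tits representation $\rho:L_n\to\mathrm{GL}(n-1,\mathbb{Z})$ is given by $\rho(y_i)=Y_i$, where $Y_i$ is the matrix that agrees with the identity except in the $i$-th row, and whose $i$-th row has $(i,i)$-entry $-1$, $(i,j)$-entry $1$ if $|i-j|=1$, and $(i,j)$-entry $2$ if $|i-j|\ge2$. For $m\ge2$, $L_n[m]$ is the kernel of the composition of $\rho$ with the reduction $\mathrm{GL}(n-1,\mathbb{Z})\to\mathrm{GL}(n-1,\mathbb{Z}/m\mathbb{Z})$. *)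

theory Defs
  imports
    "HOL-Algebra.Sym_Groups"
    "HOL-Algebra.IntRing"
    "HOL-Number_Theory.Residues"
    "Jordan_Normal_Form.Matrix"
begin

section \<open>Groups given by generators and relations\<close>

text \<open>The letter \<open>(a, True)\<close> stands for the generator \<open>a\<close>, and \<open>(a, False)\<close> for its formal
  inverse. A relation \<open>l = r\<close> is given as the pair \<open>(l, r)\<close> of words.\<close>

type_synonym 'a word = "('a \<times> bool) list"

definition words :: "'a set \<Rightarrow> 'a word set" where
  "words A = lists (A \<times> UNIV)"

inductive pres_cong :: "'a set \<Rightarrow> ('a word \<times> 'a word) set \<Rightarrow> 'a word \<Rightarrow> 'a word \<Rightarrow> bool"
  for A :: "'a set" and R :: "('a word \<times> 'a word) set" where
  refl: "w \<in> words A \<Longrightarrow> pres_cong A R w w"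
| sym: "pres_cong A R v w \<Longrightarrow> pres_cong A R w v"
| trans: "pres_cong A R u v \<Longrightarrow> pres_cong A R v w \<Longrightarrow> pres_cong A R u w"
| cancel: "u \<in> words A \<Longrightarrow> v \<in> words A \<Longrightarrow> a \<in> A \<Longrightarrow>
    pres_cong A R (u @ [(a, b), (a, \<not> b)] @ v) (u @ v)"
| relation: "u \<in> words A \<Longrightarrow> v \<in> words A \<Longrightarrow> (l, r) \<in> R \<Longrightarrow> l \<in> words A \<Longrightarrow> r \<in> words A \<Longrightarrow>
    pres_cong A R (u @ l @ v) (u @ r @ v)"

definition pres_class :: "'a set \<Rightarrow> ('a word \<times> 'a word) set \<Rightarrow> 'a word \<Rightarrow> 'a word set" where
  "pres_class A R w = {v. pres_cong A R w v}"

text \<open>The group \<open>\<langle>A | R\<rangle>\<close>. Multiplication is concatenation of representatives; see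
  \<open>pres_mult\<close> below.\<close>

definition pres_group :: "'a set \<Rightarrow> ('a word \<times> 'a word) set \<Rightarrow> 'a word set monoid" where
  "pres_group A R = \<lparr>carrier = pres_class A R ` words A,
     mult = (\<lambda>X Y. \<Union>u\<in>X. \<Union>v\<in>Y. pres_class A R (u @ v)),
     one = pres_class A R []\<rparr>"

fun word_eval :: "('b, 'c) monoid_scheme \<Rightarrow> ('a \<Rightarrow> 'b) \<Rightarrow> 'a word \<Rightarrow> 'b" where
  "word_eval H f [] = \<one>\<^bsub>H\<^esub>"
| "word_eval H f ((a, b) # w) = (if b then f a else inv\<^bsub>H\<^esub> f a) \<otimes>\<^bsub>H\<^esub> word_eval H f w"

text \<open>The homomorphism from \<open>\<langle>A | R\<rangle>\<close> to \<open>H\<close> that sends each generator \<open>a\<close> to \<open>f a\<close>. It is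
  well defined as soon as \<open>f\<close> respects the relations; see \<open>pres_hom_hom\<close> and
  \<open>pres_hom_generator\<close> below.\<close>

definition pres_hom :: "('b, 'c) monoid_scheme \<Rightarrow> ('a \<Rightarrow> 'b) \<Rightarrow> 'a word set \<Rightarrow> 'b" where
  "pres_hom H f X = the_elem (word_eval H f ` X)"

lemma words_simps [simp]:
  "[] \<in> words A" "(x # w) \<in> words A \<longleftrightarrow> fst x \<in> A \<and> w \<in> words A"
  "(u @ v) \<in> words A \<longleftrightarrow> u \<in> words A \<and> v \<in> words A"
  by (auto simp: words_def mem_Times_iff)

lemma pres_cong_words: "pres_cong A R v w \<Longrightarrow> v \<in> words A \<and> w \<in> words A"
  by (induction rule: pres_cong.induct) auto

lemma pres_cong_context:
  assumes "pres_cong A R v w" "x \<in> words A" "y \<in> words A"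
  shows "pres_cong A R (x @ v @ y) (x @ w @ y)"
  using assms
proof (induction rule: pres_cong.induct)
  case (refl w)
  then show ?case by (simp add: pres_cong.refl)
next
  case (sym v w)
  then show ?case by (simp add: pres_cong.sym)
next
  case (trans u v w)
  then show ?case by (meson pres_cong.trans)
next
  case (cancel u v a b)
  then show ?case using pres_cong.cancel[of "x @ u" A "v @ y" a R b] by simp
next
  case (relation u v l r)
  then show ?case using pres_cong.relation[of "x @ u" A "v @ y" l r R] by simp
qed

lemma pres_cong_append:
  assumes "pres_cong A R u u'" "pres_cong A R v v'"
  shows "pres_cong A R (u @ v) (u' @ v')"
proof -
  have "pres_cong A R (u @ v) (u' @ v)"
    using pres_cong_context[OF assms(1), of "[]" v] pres_cong_words[OF assms(2)] by simp
  moreover have "pres_cong A R (u' @ v) (u' @ v')"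
    using pres_cong_context[OF assms(2), of u' "[]"] pres_cong_words[OF assms(1)] by simp
  ultimately show ?thesis by (rule pres_cong.trans)
qed

lemma pres_class_eq_iff:
  assumes "v \<in> words A"
  shows "pres_class A R v = pres_class A R w \<longleftrightarrow> pres_cong A R v w"
proof
  assume "pres_class A R v = pres_class A R w"
  moreover have "v \<in> pres_class A R v"
    using assms by (simp add: pres_class_def pres_cong.refl)
  ultimately show "pres_cong A R v w"
    by (simp add: pres_class_def pres_cong.sym)
next
  assume "pres_cong A R v w"
  then have "pres_cong A R v x \<longleftrightarrow> pres_cong A R w x" for x
    by (meson pres_cong.sym pres_cong.trans)
  then show "pres_class A R v = pres_class A R w"
    by (simp add: pres_class_def)
qed

lemma pres_mult:
  assumes "v \<in> words A" "w \<in> words A"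
  shows "pres_class A R v \<otimes>\<^bsub>pres_group A R\<^esub> pres_class A R w = pres_class A R (v @ w)"
proof -
  have eq: "pres_class A R (x @ y) = pres_class A R (v @ w)"
    if "x \<in> pres_class A R v" "y \<in> pres_class A R w" for x y
  proof -
    have "pres_cong A R (v @ w) (x @ y)"
      using that by (intro pres_cong_append) (simp_all add: pres_class_def)
    then show ?thesis
      using assms pres_class_eq_iff[of "v @ w" A R "x @ y"] by simp
  qed
  have "v \<in> pres_class A R v" "w \<in> pres_class A R w"
    using assms by (simp_all add: pres_class_def pres_cong.refl)
  then have "(\<Union>x\<in>pres_class A R v. \<Union>y\<in>pres_class A R w. pres_class A R (v @ w))
      = pres_class A R (v @ w)" by blast
  then show ?thesis
    by (simp add: pres_group_def eq)
qed

lemma words_inverse: "w \<in> words A \<Longrightarrow> rev (map (apsnd Not) w) \<in> words A"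
  by (induction w) auto

lemma pres_word_inverse:
  assumes "w \<in> words A"
  shows "pres_cong A R (rev (map (apsnd Not) w) @ w) []"
  using assms
proof (induction w)
  case (Cons x w)
  obtain a b where x: "x = (a, b)" by fastforce
  have inv: "rev (map (apsnd Not) w) \<in> words A"
    using Cons.prems by (simp add: words_inverse)
  have "pres_cong A R (rev (map (apsnd Not) w) @ [(a, \<not> b), (a, \<not> \<not> b)] @ w)
      (rev (map (apsnd Not) w) @ w)"
    using Cons.prems inv x by (intro pres_cong.cancel) auto
  moreover have "pres_cong A R (rev (map (apsnd Not) w) @ w) []"
    using Cons by simp
  ultimately show ?case by (simp add: x pres_cong.trans)
qed (simp add: pres_cong.refl)

lemma group_pres_group: "group (pres_group A R)"
proof (rule groupI)
  have carr: "carrier (pres_group A R) = pres_class A R ` words A"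
    and one: "\<one>\<^bsub>pres_group A R\<^esub> = pres_class A R []" by (simp_all add: pres_group_def)
  show "X \<otimes>\<^bsub>pres_group A R\<^esub> Y \<in> carrier (pres_group A R)"
    if "X \<in> carrier (pres_group A R)" "Y \<in> carrier (pres_group A R)" for X Y
    using that by (auto simp: carr pres_mult)
  show "\<one>\<^bsub>pres_group A R\<^esub> \<in> carrier (pres_group A R)" by (simp add: carr one)
  show "X \<otimes>\<^bsub>pres_group A R\<^esub> Y \<otimes>\<^bsub>pres_group A R\<^esub> Z
      = X \<otimes>\<^bsub>pres_group A R\<^esub> (Y \<otimes>\<^bsub>pres_group A R\<^esub> Z)"
    if "X \<in> carrier (pres_group A R)" "Y \<in> carrier (pres_group A R)"
       "Z \<in> carrier (pres_group A R)" for X Y Z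
    using that by (auto simp: carr pres_mult)
  show "\<one>\<^bsub>pres_group A R\<^esub> \<otimes>\<^bsub>pres_group A R\<^esub> X = X"
    if "X \<in> carrier (pres_group A R)" for X
    using that by (auto simp: carr one pres_mult)
  show "\<exists>Y\<in>carrier (pres_group A R). Y \<otimes>\<^bsub>pres_group A R\<^esub> X = \<one>\<^bsub>pres_group A R\<^esub>"
    if "X \<in> carrier (pres_group A R)" for X
  proof -
    obtain w where w: "w \<in> words A" "X = pres_class A R w" using \<open>X \<in> _\<close> carr by auto
    have inv: "rev (map (apsnd Not) w) \<in> words A" using w(1) by (rule words_inverse)
    have "pres_class A R (rev (map (apsnd Not) w) @ w) = pres_class A R []"
      using pres_word_inverse[OF w(1)] inv w(1) by (subst pres_class_eq_iff) auto
    then show ?thesis using w inv by (auto simp: carr one pres_mult)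
  qed
qed

context
  fixes H :: "('b, 'c) monoid_scheme" (structure) and A :: "'a set" and f :: "'a \<Rightarrow> 'b"
  assumes H: "group H" and f: "f ` A \<subseteq> carrier H"
begin

lemma word_eval_closed: "w \<in> words A \<Longrightarrow> word_eval H f w \<in> carrier H"
proof (induction w)
  interpret group H by (rule H)
  case (Cons x w)
  then show ?case using f by (cases x) auto
qed (use H in \<open>simp add: group.is_monoid monoid.one_closed\<close>)

lemma word_eval_append:
  assumes "v \<in> words A" "w \<in> words A"
  shows "word_eval H f (v @ w) = word_eval H f v \<otimes> word_eval H f w"
  using assms(1)
proof (induction v)
  interpret group H by (rule H)
  case Nil
  show ?case using assms(2) by (simp add: word_eval_closed)
next
  interpret group H by (rule H)
  case (Cons x v)
  then show ?case using f assms(2) by (cases x) (auto simp: word_eval_closed m_assoc)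
qed

context
  fixes R :: "('a word \<times> 'a word) set"
  assumes R: "\<And>l r. (l, r) \<in> R \<Longrightarrow> word_eval H f l = word_eval H f r"
begin

lemma word_eval_cong: "pres_cong A R v w \<Longrightarrow> word_eval H f v = word_eval H f w"
proof (induction rule: pres_cong.induct)
  interpret group H by (rule H)
  case (cancel u v a b)
  then have "f a \<in> carrier H" using f by auto
  then have "word_eval H f [(a, b), (a, \<not> b)] = \<one>" by simp
  moreover have "[(a, b), (a, \<not> b)] \<in> words A" using cancel by simp
  ultimately show ?case
    using cancel by (subst word_eval_append, simp, simp, subst word_eval_append, simp_all only:)
      (simp add: word_eval_append word_eval_closed)
next
  case (relation u v l r)
  then show ?case by (simp add: word_eval_append R[OF relation(3)])
qed simp_all

lemma pres_hom_class: "w \<in> words A \<Longrightarrow> pres_hom H f (pres_class A R w) = word_eval H f w"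
proof -
  assume w: "w \<in> words A"
  have "word_eval H f v = word_eval H f w" if "v \<in> pres_class A R w" for v
    using that word_eval_cong[of w v] by (simp add: pres_class_def)
  moreover have "w \<in> pres_class A R w"
    using w by (simp add: pres_class_def pres_cong.refl)
  ultimately have "word_eval H f ` pres_class A R w = {word_eval H f w}"
    by blast
  then show ?thesis by (simp add: pres_hom_def)
qed

lemma pres_hom_generator: "a \<in> A \<Longrightarrow> pres_hom H f (pres_class A R [(a, True)]) = f a"
proof -
  interpret group H by (rule H)
  assume "a \<in> A"
  then show ?thesis using f by (subst pres_hom_class) auto
qed

lemma pres_hom_hom: "pres_hom H f \<in> hom (pres_group A R) H"
proof (rule homI)
  have carr: "carrier (pres_group A R) = pres_class A R ` words A" by (simp add: pres_group_def)
  show "pres_hom H f X \<in> carrier H" if "X \<in> carrier (pres_group A R)" for X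
    using that by (auto simp: carr pres_hom_class word_eval_closed)
  show "pres_hom H f (X \<otimes>\<^bsub>pres_group A R\<^esub> Y) = pres_hom H f X \<otimes> pres_hom H f Y"
    if "X \<in> carrier (pres_group A R)" "Y \<in> carrier (pres_group A R)" for X Y
    using that by (auto simp: carr pres_hom_class pres_mult word_eval_append)
qed

end

end


section \<open>General linear groups\<close>

text \<open>Matrices over a ring \<open>R\<close> given as a structure; the type-class operations on
  \<^typ>\<open>'a mat\<close> are not available for \<open>R = residue_ring m\<close>.\<close>

definition mat_monoid :: "nat \<Rightarrow> ('a, 'b) ring_scheme \<Rightarrow> 'a mat monoid" where
  "mat_monoid k R = \<lparr>carrier = {M \<in> carrier_mat k k. elements_mat M \<subseteq> carrier R},
     mult = (\<lambda>M N. mat k k (\<lambda>(i, j). \<Oplus>\<^bsub>R\<^esub>l\<in>{0..<k}. M $$ (i, l) \<otimes>\<^bsub>R\<^esub> N $$ (l, j))),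
     one = mat k k (\<lambda>(i, j). if i = j then \<one>\<^bsub>R\<^esub> else \<zero>\<^bsub>R\<^esub>)\<rparr>"

definition GL :: "nat \<Rightarrow> ('a, 'b) ring_scheme \<Rightarrow> 'a mat monoid" where
  "GL k R = units_of (mat_monoid k R)"

definition reduce_mat :: "nat \<Rightarrow> int mat \<Rightarrow> int mat" where
  "reduce_mat m = map_mat (\<lambda>x. x mod int m)"

lemma carrier_mat_monoid_int: "carrier (mat_monoid k int_ring) = carrier_mat k k"
  by (simp add: mat_monoid_def)

lemma one_mat_monoid_int: "\<one>\<^bsub>mat_monoid k int_ring\<^esub> = 1\<^sub>m k"
  by (rule eq_matI) (simp_all add: mat_monoid_def)

lemma mult_mat_monoid_int:
  assumes "M \<in> carrier_mat k k" "N \<in> carrier_mat k k"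
  shows "M \<otimes>\<^bsub>mat_monoid k int_ring\<^esub> N = M * N"
proof (rule eq_matI)
  fix i j assume "i < dim_row (M * N)" "j < dim_col (M * N)"
  then show "(M \<otimes>\<^bsub>mat_monoid k int_ring\<^esub> N) $$ (i, j) = (M * N) $$ (i, j)"
    using assms by (simp add: mat_monoid_def int_finsum_eq scalar_prod_def)
qed (use assms in \<open>simp_all add: mat_monoid_def\<close>)

lemmas mat_monoid_int = carrier_mat_monoid_int one_mat_monoid_int mult_mat_monoid_int

lemma group_GL_int: "group (GL k int_ring)"
proof -
  have "monoid (mat_monoid k int_ring)"
    by (rule monoidI) (auto simp: mat_monoid_int)
  then show ?thesis unfolding GL_def by (rule monoid.units_group)
qed

lemma finsum_residue_ring:
  assumes "m \<ge> 2" "finite S"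
  shows "finsum (residue_ring (int m)) (\<lambda>x. f x mod int m) S = (\<Sum>x\<in>S. f x) mod int m"
proof -
  interpret residues "int m" "residue_ring (int m)" using assms(1) by unfold_locales auto
  have *: "f x mod int m \<in> carrier (residue_ring (int m))" for x
    using assms(1) by (simp add: residue_ring_def)
  interpret cring "residue_ring (int m)" by (rule cring)
  from assms(2) show ?thesis
    by (induction S) (use assms(1) in \<open>simp_all add: * finsum_insert zero_cong res_add_eq mod_simps\<close>)
qed

lemma reduce_mat_closed:
  assumes "m \<ge> 2" "M \<in> carrier_mat k k"
  shows "reduce_mat m M \<in> carrier (mat_monoid k (residue_ring (int m)))"
  using assms by (auto simp: mat_monoid_def reduce_mat_def residue_ring_def)

lemma reduce_mat_mult:
  assumes "m \<ge> 2" "M \<in> carrier_mat k k" "N \<in> carrier_mat k k"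
  shows "reduce_mat m (M * N)
    = reduce_mat m M \<otimes>\<^bsub>mat_monoid k (residue_ring (int m))\<^esub> reduce_mat m N"
proof -
  have "x \<otimes>\<^bsub>residue_ring (int m)\<^esub> y = x * y mod int m" for x y
    by (simp add: residue_ring_def)
  moreover have "(\<Sum>l\<in>{0..<k}. M $$ (i, l) mod int m * (N $$ (l, j) mod int m)) mod int m
      = (\<Sum>l\<in>{0..<k}. M $$ (i, l) * N $$ (l, j)) mod int m" for i j
    by (subst (1 2) mod_sum_eq[symmetric]) (simp add: mod_mult_eq)
  ultimately show ?thesis
    using assms by (auto simp: mat_monoid_def reduce_mat_def finsum_residue_ring scalar_prod_def
        intro!: eq_matI)
qed

lemma reduce_mat_one:
  assumes "m \<ge> 2"
  shows "reduce_mat m (1\<^sub>m k) = \<one>\<^bsub>mat_monoid k (residue_ring (int m))\<^esub>"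
  using assms by (auto simp: mat_monoid_def reduce_mat_def residue_ring_def intro!: eq_matI)

lemma reduce_mat_hom:
  assumes "m \<ge> 2"
  shows "reduce_mat m \<in> hom (GL k int_ring) (GL k (residue_ring (int m)))"
proof (rule homI)
  show "reduce_mat m M \<in> carrier (GL k (residue_ring (int m)))"
    if M: "M \<in> carrier (GL k int_ring)" for M
  proof -
    obtain N where "M \<in> carrier_mat k k" "N \<in> carrier_mat k k"
        "N \<otimes>\<^bsub>mat_monoid k int_ring\<^esub> M = 1\<^sub>m k" "M \<otimes>\<^bsub>mat_monoid k int_ring\<^esub> N = 1\<^sub>m k"
      using M unfolding GL_def units_of_carrier Units_def carrier_mat_monoid_int one_mat_monoid_int
      by blast
    then have "M \<in> carrier_mat k k" "N \<in> carrier_mat k k" "M * N = 1\<^sub>m k" "N * M = 1\<^sub>m k"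
      by (simp_all add: mult_mat_monoid_int)
    then show ?thesis
      using reduce_mat_closed[OF assms] reduce_mat_mult[OF assms, of M k N]
        reduce_mat_mult[OF assms, of N k M] reduce_mat_one[OF assms, of k]
      by (auto simp: GL_def units_of_carrier Units_def)
  qed
  show "reduce_mat m (M \<otimes>\<^bsub>GL k int_ring\<^esub> N)
      = reduce_mat m M \<otimes>\<^bsub>GL k (residue_ring (int m))\<^esub> reduce_mat m N"
    if "M \<in> carrier (GL k int_ring)" "N \<in> carrier (GL k int_ring)" for M N
    using that reduce_mat_mult[OF assms, of M k N]
    by (auto simp: GL_def units_of_carrier units_of_mult Units_def mat_monoid_int)
qed


section \<open>Triplet groups\<close>

definition triplet_relations :: "nat \<Rightarrow> (nat word \<times> nat word) set" where
  "triplet_relations n =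
     {([(j, True), (j, True)], []) | j. j \<in> {1..n - 1}} \<union>
     {([(i, True), (i + 1, True), (i, True)], [(i + 1, True), (i, True), (i + 1, True)]) | i.
        i \<in> {1..n - 2}}"

definition triplet_group :: "nat \<Rightarrow> nat word set monoid" where
  "triplet_group n = pres_group {1..n - 1} (triplet_relations n)"

definition triplet_perm :: "nat \<Rightarrow> nat word set \<Rightarrow> nat \<Rightarrow> nat" where
  "triplet_perm n = pres_hom (sym_group n) (\<lambda>i. Transposition.transpose i (i + 1))"

lemma transpose_braid:
  "Transposition.transpose i (i + 1) \<circ> (Transposition.transpose (i + 1) (i + 2) \<circ> Transposition.transpose i (i + 1))
    = Transposition.transpose (i + 1) (i + 2) \<circ> (Transposition.transpose i (i + 1) \<circ> Transposition.transpose (i + 1) (i + 2))"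
  for i :: nat
proof
  fix x
  consider "x = i" | "x = i + 1" | "x = i + 2" | "x \<notin> {i, i + 1, i + 2}" by blast
  then show "(Transposition.transpose i (i + 1) \<circ> (Transposition.transpose (i + 1) (i + 2) \<circ> Transposition.transpose i (i + 1))) x
    = (Transposition.transpose (i + 1) (i + 2) \<circ> (Transposition.transpose i (i + 1) \<circ> Transposition.transpose (i + 1) (i + 2))) x"
    by cases (simp_all add: Transposition.transpose_def)
qed

lemma triplet_relations_cases:
  assumes "(l, r) \<in> triplet_relations n"
  obtains j where "j \<in> {1..n - 1}" "l = [(j, True), (j, True)]" "r = []"
  | i where "i \<in> {1..n - 2}" "l = [(i, True), (i + 1, True), (i, True)]"
      "r = [(i + 1, True), (i, True), (i + 1, True)]"
  using assms unfolding triplet_relations_def by blast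

lemma triplet_perm_relations:
  assumes "(l, r) \<in> triplet_relations n"
  shows "word_eval (sym_group n) (\<lambda>i. Transposition.transpose i (i + 1)) l
    = word_eval (sym_group n) (\<lambda>i. Transposition.transpose i (i + 1)) r"
  using assms
proof (cases rule: triplet_relations_cases)
  case (2 i)
  then show ?thesis using transpose_braid[of i]
    by (simp add: sym_group_mult sym_group_one)
qed (simp add: sym_group_mult sym_group_one)

lemma transpose_sym_group:
  "(\<lambda>i. Transposition.transpose i (i + 1)) ` {1..n - 1} \<subseteq> carrier (sym_group n)"
  by (auto simp: sym_group_carrier intro!: permutes_swap_id)

lemma triplet_perm_hom: "triplet_perm n \<in> hom (triplet_group n) (sym_group n)"
  unfolding triplet_perm_def triplet_group_def
  by (intro pres_hom_hom sym_group_is_group transpose_sym_group triplet_perm_relations)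

lemma word_eval_adj_transps:
  "word_eval (sym_group n) (\<lambda>i. Transposition.transpose i (i + 1)) (map (\<lambda>x. (x, True)) xs)
    = apply_adj_transps xs"
  by (induction xs) (simp_all add: sym_group_mult sym_group_one)

lemma triplet_perm_epi: "triplet_perm n \<in> epi (triplet_group n) (sym_group n)"
proof -
  let ?f = "\<lambda>i. Transposition.transpose i (i + 1)" and ?A = "{1..n - 1}"
  have transp: "\<exists>w\<in>words ?A. word_eval (sym_group n) ?f w = Transposition.transpose a b"
    if "a < b" "a \<in> {1..n}" "b \<in> {1..n}" for a b
  proof -
    have "set (adj_transp_seq a b) \<subseteq> ?A"
      using that by (auto simp: set_adj_transp_seq)
    then have "map (\<lambda>x. (x, True)) (adj_transp_seq a b) \<in> words ?A"
      by (auto simp: words_def)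
    then show ?thesis
      using that(1) by (metis word_eval_adj_transps adj_transp_seq_correct)
  qed
  have "\<exists>w\<in>words ?A. word_eval (sym_group n) ?f w = p" if "p permutes {1..n}" for p
    using finite_atLeastAtMost that
  proof (induction p rule: permutes_rev_induct)
    case id
    show ?case by (rule bexI[of _ "[]"]) (simp_all add: sym_group_one)
  next
    case (swap a b p)
    then obtain w where w: "w \<in> words ?A" "word_eval (sym_group n) ?f w = p" by blast
    have "\<exists>u\<in>words ?A. word_eval (sym_group n) ?f u = Transposition.transpose a b"
    proof (cases a b rule: linorder_cases)
      case equal
      then show ?thesis by (intro bexI[of _ "[]"]) (simp_all add: sym_group_one)
    next
      case less
      then show ?thesis by (rule transp[OF _ swap(1,2)])
    next
      case greater
      then show ?thesis
        using transp[OF _ swap(2,1)] by (simp only: transpose_commute[of b a])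
    qed
    then obtain u where u: "u \<in> words ?A"
      "word_eval (sym_group n) ?f u = Transposition.transpose a b" by blast
    have "word_eval (sym_group n) ?f (w @ u) = p \<circ> Transposition.transpose a b"
      using word_eval_append[OF sym_group_is_group transpose_sym_group w(1) u(1)] w(2) u(2)
      by (simp add: sym_group_mult)
    then show ?case using w(1) u(1) by (intro bexI[of _ "w @ u"]) auto
  qed
  moreover have "triplet_perm n (pres_class ?A (triplet_relations n) w) = word_eval (sym_group n) ?f w"
    if "w \<in> words ?A" for w
    unfolding triplet_perm_def
    by (rule pres_hom_class[OF sym_group_is_group transpose_sym_group _ that])
      (rule triplet_perm_relations)
  ultimately have "carrier (sym_group n) \<subseteq> triplet_perm n ` carrier (triplet_group n)"
    by (force simp: sym_group_carrier triplet_group_def pres_group_def)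
  then show ?thesis
    using triplet_perm_hom[of n] by (auto simp: epi_def hom_def)
qed

definition pure_triplet_group :: "nat \<Rightarrow> nat word set set" where
  "pure_triplet_group n = kernel (triplet_group n) (sym_group n) (triplet_perm n)"

text \<open>The generators are numbered from \<open>1\<close> and matrix rows and columns from \<open>0\<close>, so the
  \<open>i\<close>-th row of \<open>Y\<^sub>i\<close> is row \<open>i - 1\<close> here.\<close>

definition tits_matrix :: "nat \<Rightarrow> nat \<Rightarrow> int mat" where
  "tits_matrix n i = mat (n - 1) (n - 1) (\<lambda>(r, c).
     let k = r + 1; j = c + 1 in
       if k \<noteq> i then (if k = j then 1 else 0)
       else if j = i then - 1
       else if \<bar>int i - int j\<bar> = 1 then 1
       else 2)"

lemma tits_matrix_carrier: "tits_matrix n i \<in> carrier_mat (n - 1) (n - 1)"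
  by (simp add: tits_matrix_def)

text \<open>The \<open>i\<close>-th row of \<open>Y\<^sub>i - 1\<close>; used only in the proof that \<open>tits_rep\<close> is a
  homomorphism.\<close>

definition tits_offset :: "nat \<Rightarrow> nat \<Rightarrow> int" where
  "tits_offset i c = (if c + 1 = i then - 2 else if c + 2 = i \<or> c = i then 1 else 2)"

lemma tits_matrix_index:
  assumes "r < n - 1" "c < n - 1"
  shows "tits_matrix n i $$ (r, c) =
    (if r = c then 1 else 0) + (if r + 1 = i then tits_offset i c else 0)"
  using assms by (auto simp: tits_matrix_def tits_offset_def Let_def)

lemma mult_tits_matrix_index:
  assumes "i \<in> {1..n - 1}" "M \<in> carrier_mat (n - 1) (n - 1)" "r < n - 1" "c < n - 1"
  shows "(M * tits_matrix n i) $$ (r, c) = M $$ (r, c) + M $$ (r, i - 1) * tits_offset i c"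
proof -
  have "(M * tits_matrix n i) $$ (r, c) = (\<Sum>l\<in>{0..<n - 1}. M $$ (r, l) * tits_matrix n i $$ (l, c))"
    using assms tits_matrix_carrier[of n i] by (auto simp: scalar_prod_def)
  also have "\<dots> = (\<Sum>l\<in>{0..<n - 1}. (if l = c then M $$ (r, l) else 0)
      + (if l = i - 1 then M $$ (r, l) * tits_offset i c else 0))"
  proof (rule sum.cong)
    fix l assume "l \<in> {0..<n - 1}"
    moreover have "l + 1 = i \<longleftrightarrow> l = i - 1" using assms(1) by auto
    ultimately show "M $$ (r, l) * tits_matrix n i $$ (l, c) = (if l = c then M $$ (r, l) else 0)
      + (if l = i - 1 then M $$ (r, l) * tits_offset i c else 0)"
      using assms(4) by (simp add: tits_matrix_index algebra_simps)
  qed simp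
  also have "\<dots> = M $$ (r, c) + M $$ (r, i - 1) * tits_offset i c"
  proof -
    have "i - 1 < n - 1" using assms(1) by auto
    then show ?thesis using assms(4) by (simp add: sum.distrib)
  qed
  finally show ?thesis .
qed

lemma tits_matrix_square:
  assumes "i \<in> {1..n - 1}"
  shows "tits_matrix n i * tits_matrix n i = 1\<^sub>m (n - 1)"
proof (rule eq_matI)
  fix r c assume "r < dim_row (1\<^sub>m (n - 1) :: int mat)" "c < dim_col (1\<^sub>m (n - 1) :: int mat)"
  then have rc: "r < n - 1" "c < n - 1" by simp_all
  have i: "i - 1 < n - 1" "r = i - 1 \<longleftrightarrow> r + 1 = i" using assms by auto
  have "tits_offset i (i - 1) = - 2" using assms by (simp add: tits_offset_def)
  moreover have "(tits_matrix n i * tits_matrix n i) $$ (r, c)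
      = tits_matrix n i $$ (r, c) + tits_matrix n i $$ (r, i - 1) * tits_offset i c"
    by (rule mult_tits_matrix_index[OF assms tits_matrix_carrier rc])
  ultimately show "(tits_matrix n i * tits_matrix n i) $$ (r, c) = 1\<^sub>m (n - 1) $$ (r, c)"
    using rc i by (simp add: tits_matrix_index)
qed (use tits_matrix_carrier[of n i] in auto)

lemma tits_matrix_braid:
  assumes "i \<in> {1..n - 2}"
  shows "tits_matrix n i * tits_matrix n (i + 1) * tits_matrix n i
    = tits_matrix n (i + 1) * tits_matrix n i * tits_matrix n (i + 1)"
proof (rule eq_matI)
  let ?A = "tits_matrix n i" and ?B = "tits_matrix n (i + 1)"
  fix r c assume "r < dim_row (?B * ?A * ?B)" "c < dim_col (?B * ?A * ?B)"
  then have rc: "r < n - 1" "c < n - 1" using tits_matrix_carrier[of n "i + 1"] by auto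
  have i: "i \<in> {1..n - 1}" "i + 1 \<in> {1..n - 1}" "i - 1 < n - 1" "i < n - 1"
      "r = i - 1 \<longleftrightarrow> r + 1 = i" using assms by auto
  have off: "tits_offset i (i - 1) = - 2" "tits_offset (i + 1) (i - 1) = 1"
      "tits_offset i i = 1" "tits_offset (i + 1) i = - 2"
    using assms by (auto simp: tits_offset_def)
  have closed: "?A * ?B \<in> carrier_mat (n - 1) (n - 1)" "?B * ?A \<in> carrier_mat (n - 1) (n - 1)"
    using tits_matrix_carrier by (auto intro!: mult_carrier_mat)
  have "(?A * ?B * ?A) $$ (r, c) = (?A * ?B) $$ (r, c) + (?A * ?B) $$ (r, i - 1) * tits_offset i c"
    by (rule mult_tits_matrix_index[OF i(1) closed(1) rc])
  moreover have "(?B * ?A * ?B) $$ (r, c) = (?B * ?A) $$ (r, c) + (?B * ?A) $$ (r, i) * tits_offset (i + 1) c"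
    using mult_tits_matrix_index[OF i(2) closed(2) rc] by simp
  moreover have "(?A * ?B) $$ (r, k) = ?A $$ (r, k) + ?A $$ (r, i) * tits_offset (i + 1) k"
    if "k < n - 1" for k
    using mult_tits_matrix_index[OF i(2) tits_matrix_carrier rc(1) that] by simp
  moreover have "(?B * ?A) $$ (r, k) = ?B $$ (r, k) + ?B $$ (r, i - 1) * tits_offset i k"
    if "k < n - 1" for k
    by (rule mult_tits_matrix_index[OF i(1) tits_matrix_carrier rc(1) that])
  ultimately show "(?A * ?B * ?A) $$ (r, c) = (?B * ?A * ?B) $$ (r, c)"
    using rc i off by (simp add: tits_matrix_index algebra_simps)
qed (use tits_matrix_carrier[of n i] tits_matrix_carrier[of n "i + 1"] in auto)

lemma GL_int_mult:
  "M \<in> carrier_mat k k \<Longrightarrow> N \<in> carrier_mat k k \<Longrightarrow> M \<otimes>\<^bsub>GL k int_ring\<^esub> N = M * N"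
  by (simp add: GL_def units_of_mult mult_mat_monoid_int)

lemma GL_int_one: "\<one>\<^bsub>GL k int_ring\<^esub> = 1\<^sub>m k"
  by (simp add: GL_def units_of_one one_mat_monoid_int)

lemma tits_matrix_GL: "tits_matrix n ` {1..n - 1} \<subseteq> carrier (GL (n - 1) int_ring)"
proof
  fix M assume "M \<in> tits_matrix n ` {1..n - 1}"
  then have M: "M \<in> carrier_mat (n - 1) (n - 1)" "M * M = 1\<^sub>m (n - 1)"
    using tits_matrix_carrier tits_matrix_square by blast+
  then show "M \<in> carrier (GL (n - 1) int_ring)"
    unfolding GL_def units_of_carrier Units_def
    by (auto simp: mat_monoid_int)
qed

lemma tits_relations:
  assumes "(l, r) \<in> triplet_relations n"
  shows "word_eval (GL (n - 1) int_ring) (tits_matrix n) l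
    = word_eval (GL (n - 1) int_ring) (tits_matrix n) r"
  using assms
proof (cases rule: triplet_relations_cases)
  case (1 j)
  then show ?thesis
    using tits_matrix_square[OF 1(1)] tits_matrix_carrier[of n j]
    by (simp add: GL_int_mult GL_int_one)
next
  case (2 i)
  then show ?thesis
    using tits_matrix_braid[OF 2(1)] tits_matrix_carrier[of n i] tits_matrix_carrier[of n "i + 1"]
    by (simp add: GL_int_mult GL_int_one
        assoc_mult_mat[of _ "n - 1" "n - 1" _ "n - 1" _ "n - 1"])
qed

definition tits_rep :: "nat \<Rightarrow> nat word set \<Rightarrow> int mat" where
  "tits_rep n = pres_hom (GL (n - 1) int_ring) (tits_matrix n)"

lemma tits_rep_hom: "tits_rep n \<in> hom (triplet_group n) (GL (n - 1) int_ring)"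
  unfolding tits_rep_def triplet_group_def
  by (intro pres_hom_hom group_GL_int tits_matrix_GL tits_relations)

text \<open>Meaningful for \<open>m \<ge> 2\<close>: \<open>residue_ring m\<close> has unit element \<open>1\<close> and carrier
  \<open>{0..m - 1}\<close>.\<close>

definition triplet_congruence :: "nat \<Rightarrow> nat \<Rightarrow> nat word set set" where
  "triplet_congruence n m =
     kernel (triplet_group n) (GL (n - 1) (residue_ring (int m))) (reduce_mat m \<circ> tits_rep n)"

end

theory Submission
  imports Defs
begin

text \<open>
  Modulo 2 the Tits matrices of the triplet group become those of the symmetric group: the
  entries 2 and the signs disappear, and \<open>Y\<^sub>i\<close> turns into the matrix of the transposition
  \<open>(i, i + 1)\<close> on the root lattice of type \<open>A\<close> reduced modulo 2, in the basis of simple roots.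
  The latter is the space of even-size subsets of \<open>{1..n}\<close> under symmetric difference, the simple
  root number \<open>j\<close> being the pair \<open>{j, j + 1}\<close>, and \<open>S\<^sub>n\<close> acts on it by permuting the points. So
  an element of \<open>L\<^sub>n\<close> with permutation \<open>p\<close> has Tits matrix congruent to the matrix of \<open>p\<close> on
  the pairs (\<open>tits_perm_intertwine\<close>).

  If \<open>p\<close> is the identity, the Tits matrix is therefore trivial modulo 2, because the pairs are
  linearly independent (\<open>adjacent_pairs_independent\<close>). Conversely, if the Tits matrix is trivial
  modulo 2, then \<open>p\<close> preserves every pair of neighbours in \<open>{1..n}\<close>, and for \<open>n \<ge> 3\<close> these pairs
  separate the points (\<open>adjacent_pairs_separate\<close>), whence \<open>p\<close> is the identity. For \<open>n = 2\<close>
  the only pair is the whole set, and the transposition would act trivially.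
\<close>

section \<open>Pairs of neighbours modulo 2\<close>

text \<open>The coordinates modulo 2 of the simple roots, with the zero-based index of the matrix rows:
  index \<open>l\<close> belongs to generator number \<open>l + 1\<close>.\<close>

definition adjacent_pair :: "nat \<Rightarrow> nat \<Rightarrow> int" where
  "adjacent_pair l x = of_bool (x = l + 1 \<or> x = l + 2)"

text \<open>This is the reflection formula for simple roots: swapping two neighbours adds their pair to
  exactly those pairs that overlap it in one point, and these are the indices at which
  \<open>tits_offset\<close> is odd.\<close>

lemma adjacent_pair_transpose:
  assumes "a \<ge> 1"
  shows "[adjacent_pair l (Transposition.transpose a (a + 1) x)
    = adjacent_pair l x + adjacent_pair (a - 1) x * tits_offset a l] (mod 2)"
proof -
  obtain b where "a = Suc b" using assms by (cases a) auto
  then show ?thesis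
    by (auto simp: adjacent_pair_def tits_offset_def Transposition.transpose_def cong_def)
qed

lemma sum_adjacent_pair_Suc:
  "(\<Sum>l<k. adjacent_pair l (Suc r) * v l)
    = (if r < k then v r else 0) + (if 0 < r \<and> r \<le> k then v (r - 1) else 0)"
proof -
  have "adjacent_pair l (Suc r) * v l
      = (if l = r then v l else 0) + (if l = r - 1 then (if 0 < r then v l else 0) else 0)" for l
    by (auto simp: adjacent_pair_def)
  then show ?thesis by (auto simp: sum.distrib)
qed

text \<open>The system is triangular: of the first \<open>r + 1\<close> points, the pair with index \<open>r\<close> contains
  only the last, which otherwise lies only in the pair with index \<open>r - 1\<close>.\<close>

lemma adjacent_pairs_independent:
  assumes "\<And>x. even (\<Sum>l<k. adjacent_pair l x * v l)" "r < k"
  shows "even (v r)"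
  using assms(2)
proof (induction r)
  case 0
  then show ?case using assms(1)[of 1] sum_adjacent_pair_Suc[of 0 v k] by simp
next
  case (Suc r)
  then show ?case using assms(1)[of "Suc (Suc r)"] sum_adjacent_pair_Suc[of "Suc r" v k] by simp
qed

lemma adjacent_pairs_separate:
  assumes "n \<ge> 3" "x \<in> {1..n}" "y \<in> {1..n}"
    and same: "\<And>c. c < n - 1 \<Longrightarrow> adjacent_pair c x = adjacent_pair c y"
  shows "x = y"
proof -
  \<comment> \<open>The pair to the right of \<open>x\<close> forces \<open>y = x + 1\<close>. The pair to the left of \<open>x\<close> then separates
    the two points, unless \<open>x = 1\<close>, where \<open>{2, 3}\<close> does.\<close>
  have False if "x < y" "y \<le> n" "x \<ge> 1"
    and same: "\<And>c. c < n - 1 \<Longrightarrow> adjacent_pair c x = adjacent_pair c y" for x y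
  proof -
    have y: "y = x + 1"
      using that same[of "x - 1"] by (auto simp: adjacent_pair_def split: if_splits)
    show False
    proof (cases "x = 1")
      case True
      have "1 < n - 1" using assms(1) by simp
      from same[OF this] show False using True y by (simp add: adjacent_pair_def)
    next
      case False
      define c where "c = x - 2"
      have x: "x = c + 2" using False \<open>x \<ge> 1\<close> by (simp add: c_def)
      then have "c < n - 1" using y \<open>y \<le> n\<close> by simp
      from same[OF this] show False using x y by (simp add: adjacent_pair_def)
    qed
  qed
  from this[of x y] this[of y x] show ?thesis
    using assms by (cases x y rule: linorder_cases) auto
qed


section \<open>The Tits representation modulo 2\<close>

lemma tits_mult_matrix_index:
  assumes "a \<in> {1..n - 1}" "M \<in> carrier_mat (n - 1) (n - 1)" "r < n - 1" "c < n - 1"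
  shows "(tits_matrix n a * M) $$ (r, c)
    = M $$ (r, c) + (if r = a - 1 then \<Sum>l<n - 1. tits_offset a l * M $$ (l, c) else 0)"
proof -
  have a: "r + 1 = a \<longleftrightarrow> r = a - 1" using assms(1) by auto
  have "(tits_matrix n a * M) $$ (r, c) = (\<Sum>l<n - 1. tits_matrix n a $$ (r, l) * M $$ (l, c))"
    using assms tits_matrix_carrier[of n a] by (auto simp: scalar_prod_def atLeast0LessThan)
  also have "\<dots> = (\<Sum>l<n - 1. (if l = r then M $$ (l, c) else 0)
      + (if r = a - 1 then tits_offset a l * M $$ (l, c) else 0))"
    using assms(3) a by (intro sum.cong) (auto simp: tits_matrix_index algebra_simps)
  also have "\<dots> = M $$ (r, c)
      + (if r = a - 1 then \<Sum>l<n - 1. tits_offset a l * M $$ (l, c) else 0)"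
    using assms(3) by (simp add: sum.distrib)
  finally show ?thesis .
qed

lemma sum_adjacent_pair_tits_mult:
  assumes a: "a \<in> {1..n - 1}" and M: "M \<in> carrier_mat (n - 1) (n - 1)" and c: "c < n - 1"
  shows "[(\<Sum>l<n - 1. adjacent_pair l x * (tits_matrix n a * M) $$ (l, c))
    = (\<Sum>l<n - 1. adjacent_pair l (Transposition.transpose a (a + 1) x) * M $$ (l, c))] (mod 2)"
proof -
  let ?s = "\<Sum>l<n - 1. tits_offset a l * M $$ (l, c)"
  have "(\<Sum>l<n - 1. adjacent_pair l x * (tits_matrix n a * M) $$ (l, c))
      = (\<Sum>l<n - 1. adjacent_pair l x * M $$ (l, c)
          + (if l = a - 1 then adjacent_pair l x * ?s else 0))"
    using assms by (intro sum.cong) (simp_all add: tits_mult_matrix_index algebra_simps)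
  also have "\<dots> = (\<Sum>l<n - 1. adjacent_pair l x * M $$ (l, c)) + adjacent_pair (a - 1) x * ?s"
    using a by (auto simp: sum.distrib)
  also have "\<dots> = (\<Sum>l<n - 1.
      (adjacent_pair l x + adjacent_pair (a - 1) x * tits_offset a l) * M $$ (l, c))"
    by (simp add: sum.distrib sum_distrib_left algebra_simps)
  also have "[\<dots> = (\<Sum>l<n - 1.
      adjacent_pair l (Transposition.transpose a (a + 1) x) * M $$ (l, c))] (mod 2)"
    using a by (intro cong_sum cong_mult cong_refl cong_sym[OF adjacent_pair_transpose]) auto
  finally show ?thesis .
qed

lemma inv_tits_matrix:
  assumes "a \<in> {1..n - 1}"
  shows "inv\<^bsub>GL (n - 1) int_ring\<^esub> tits_matrix n a = tits_matrix n a"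
proof (rule group.inv_equality[OF group_GL_int])
  show "tits_matrix n a \<otimes>\<^bsub>GL (n - 1) int_ring\<^esub> tits_matrix n a = \<one>\<^bsub>GL (n - 1) int_ring\<^esub>"
    using tits_matrix_square[OF assms] tits_matrix_carrier[of n a]
    by (simp add: GL_int_mult GL_int_one)
qed (use tits_matrix_GL assms in blast)+

lemma inv_transpose_sym_group:
  assumes "a \<in> {1..n - 1}"
  shows "inv\<^bsub>sym_group n\<^esub> Transposition.transpose a (a + 1) = Transposition.transpose a (a + 1)"
proof (rule group.inv_equality[OF sym_group_is_group])
  show "Transposition.transpose a (a + 1) \<otimes>\<^bsub>sym_group n\<^esub> Transposition.transpose a (a + 1)
      = \<one>\<^bsub>sym_group n\<^esub>"
    by (simp add: sym_group_mult sym_group_one)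
qed (use transpose_sym_group assms in blast)+

text \<open>Letter by letter, a Tits matrix acts on the pairs of neighbours as the permutation does. The
  permutation stands on the left-hand side, in the index of the coordinate, because its inverse
  would appear on the right.\<close>

lemma word_eval_tits_perm_intertwine:
  assumes "w \<in> words {1..n - 1}" "c < n - 1"
  shows "[(\<Sum>l<n - 1. adjacent_pair l
        (word_eval (sym_group n) (\<lambda>i. Transposition.transpose i (i + 1)) w x)
      * word_eval (GL (n - 1) int_ring) (tits_matrix n) w $$ (l, c))
    = adjacent_pair c x] (mod 2)"
  using assms(1)
proof (induction w)
  case Nil
  have "(\<Sum>l<n - 1. adjacent_pair l x * 1\<^sub>m (n - 1) $$ (l, c))
      = (\<Sum>l<n - 1. if l = c then adjacent_pair l x else 0)"
    using assms(2) by (intro sum.cong) auto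
  also have "\<dots> = adjacent_pair c x" using assms(2) by simp
  finally show ?case by (simp add: sym_group_one GL_int_one)
next
  case (Cons z w)
  obtain a b where z: "z = (a, b)" by fastforce
  let ?t = "\<lambda>i. Transposition.transpose i (i + 1)"
  let ?p = "word_eval (sym_group n) ?t w"
  let ?M = "word_eval (GL (n - 1) int_ring) (tits_matrix n) w"
  have a: "a \<in> {1..n - 1}" and w: "w \<in> words {1..n - 1}"
    using Cons.prems z by simp_all
  have "?M \<in> carrier (GL (n - 1) int_ring)"
    using word_eval_closed[OF group_GL_int tits_matrix_GL w] .
  then have M: "?M \<in> carrier_mat (n - 1) (n - 1)"
    by (auto simp: GL_def units_of_carrier Units_def mat_monoid_int)
  have "word_eval (sym_group n) ?t (z # w) = ?t a \<circ> ?p"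
    using inv_transpose_sym_group[OF a] by (simp add: z sym_group_mult)
  moreover have "word_eval (GL (n - 1) int_ring) (tits_matrix n) (z # w) = tits_matrix n a * ?M"
    using inv_tits_matrix[OF a] M tits_matrix_carrier[of n a] by (simp add: z GL_int_mult)
  moreover have "[(\<Sum>l<n - 1. adjacent_pair l (?t a (?p x)) * (tits_matrix n a * ?M) $$ (l, c))
      = (\<Sum>l<n - 1. adjacent_pair l (?p x) * ?M $$ (l, c))] (mod 2)"
    using sum_adjacent_pair_tits_mult[OF a M assms(2), of "?t a (?p x)"]
    by (simp only: transpose_involutory)
  ultimately show ?case
    using cong_trans[OF _ Cons.IH[OF w]] by (simp only: comp_apply)
qed

lemma tits_perm_intertwine:
  assumes "X \<in> carrier (triplet_group n)" "c < n - 1"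
  shows "[(\<Sum>l<n - 1. adjacent_pair l (triplet_perm n X x) * tits_rep n X $$ (l, c))
    = adjacent_pair c x] (mod 2)"
proof -
  obtain w where w: "w \<in> words {1..n - 1}" "X = pres_class {1..n - 1} (triplet_relations n) w"
    using assms(1) by (auto simp: triplet_group_def pres_group_def)
  have "triplet_perm n X = word_eval (sym_group n) (\<lambda>i. Transposition.transpose i (i + 1)) w"
    unfolding triplet_perm_def w(2)
    by (rule pres_hom_class[OF sym_group_is_group transpose_sym_group _ w(1)])
      (rule triplet_perm_relations)
  moreover have "tits_rep n X = word_eval (GL (n - 1) int_ring) (tits_matrix n) w"
    unfolding tits_rep_def w(2)
    by (rule pres_hom_class[OF group_GL_int tits_matrix_GL _ w(1)]) (rule tits_relations)
  ultimately show ?thesis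
    using word_eval_tits_perm_intertwine[OF w(1) assms(2), of x] by simp
qed


section \<open>Comparison of the kernels\<close>

lemma reduce_mat_eq_one_iff:
  assumes "m \<ge> 2" "M \<in> carrier_mat k k"
  shows "reduce_mat m M = \<one>\<^bsub>GL k (residue_ring (int m))\<^esub>
    \<longleftrightarrow> (\<forall>r<k. \<forall>c<k. [M $$ (r, c) = 1\<^sub>m k $$ (r, c)] (mod int m))"
proof -
  have "\<one>\<^bsub>GL k (residue_ring (int m))\<^esub> = reduce_mat m (1\<^sub>m k)"
    using reduce_mat_one[OF assms(1), of k] by (simp add: GL_def units_of_one)
  then show ?thesis
    using assms(2) by (auto simp: reduce_mat_def mat_eq_iff cong_def)
qed

lemma tits_rep_trivial_mod_2_iff:
  assumes "n \<ge> 3" and X: "X \<in> carrier (triplet_group n)"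
  shows "(\<forall>r<n - 1. \<forall>c<n - 1. [tits_rep n X $$ (r, c) = 1\<^sub>m (n - 1) $$ (r, c)] (mod 2))
    \<longleftrightarrow> triplet_perm n X = id"
proof -
  let ?p = "triplet_perm n X" and ?M = "tits_rep n X" and ?I = "1\<^sub>m (n - 1) :: int mat"
  have column: "(\<Sum>l<n - 1. adjacent_pair l x * ?I $$ (l, c)) = adjacent_pair c x"
    if "c < n - 1" for c x
  proof -
    have "(\<Sum>l<n - 1. adjacent_pair l x * ?I $$ (l, c))
        = (\<Sum>l<n - 1. if l = c then adjacent_pair l x else 0)"
      using that by (intro sum.cong) auto
    then show ?thesis using that by simp
  qed
  have perm: "?p permutes {1..n}"
    using hom_in_carrier[OF triplet_perm_hom X] by (simp add: sym_group_carrier)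
  show ?thesis
  proof
    assume triv: "\<forall>r<n - 1. \<forall>c<n - 1. [?M $$ (r, c) = ?I $$ (r, c)] (mod 2)"
    have pairs: "adjacent_pair c (?p x) = adjacent_pair c x" if c: "c < n - 1" for c x
    proof -
      have "[(\<Sum>l<n - 1. adjacent_pair l (?p x) * ?M $$ (l, c))
          = (\<Sum>l<n - 1. adjacent_pair l (?p x) * ?I $$ (l, c))] (mod 2)"
        using triv c by (intro cong_sum cong_mult cong_refl) auto
      then have "[adjacent_pair c (?p x) = adjacent_pair c x] (mod 2)"
        using tits_perm_intertwine[OF X c, of x] column[OF c]
        by (metis cong_sym cong_trans)
      \<comment> \<open>The values are 0 and 1, so congruence modulo 2 is equality.\<close>
      then show ?thesis by (auto simp: adjacent_pair_def cong_def split: if_splits)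
    qed
    show "?p = id"
    proof
      fix x
      show "?p x = id x"
      proof (cases "x \<in> {1..n}")
        case True
        then have "?p x \<in> {1..n}" using permutes_in_image[OF perm] by blast
        from adjacent_pairs_separate[OF assms(1) this True pairs] show ?thesis by simp
      qed (simp add: permutes_not_in[OF perm])
    qed
  next
    assume id: "?p = id"
    show "\<forall>r<n - 1. \<forall>c<n - 1. [?M $$ (r, c) = ?I $$ (r, c)] (mod 2)"
    proof (intro allI impI)
      fix r c assume r: "r < n - 1" and c: "c < n - 1"
      have "even (\<Sum>l<n - 1. adjacent_pair l x * (?M $$ (l, c) - ?I $$ (l, c)))" for x
      proof -
        have "[(\<Sum>l<n - 1. adjacent_pair l x * ?M $$ (l, c))
            = (\<Sum>l<n - 1. adjacent_pair l x * ?I $$ (l, c))] (mod 2)"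
          using tits_perm_intertwine[OF X c, of x] column[OF c, of x] id by simp
        then show ?thesis
          by (simp add: cong_iff_dvd_diff right_diff_distrib sum_subtractf)
      qed
      from adjacent_pairs_independent[OF this r]
      show "[?M $$ (r, c) = ?I $$ (r, c)] (mod 2)"
        by (simp add: cong_iff_dvd_diff)
    qed
  qed
qed

theorem proposition3p24:
  fixes n :: nat
  assumes "n \<ge> 3"
  shows "triplet_congruence n 2 = pure_triplet_group n"
proof -
  have "(reduce_mat 2 \<circ> tits_rep n) X = \<one>\<^bsub>GL (n - 1) (residue_ring (int 2))\<^esub>
      \<longleftrightarrow> triplet_perm n X = \<one>\<^bsub>sym_group n\<^esub>"
    if X: "X \<in> carrier (triplet_group n)" for X
  proof -
    have "tits_rep n X \<in> carrier_mat (n - 1) (n - 1)"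
      using hom_in_carrier[OF tits_rep_hom X]
      by (auto simp: GL_def units_of_carrier Units_def mat_monoid_int)
    from reduce_mat_eq_one_iff[OF order_refl this] show ?thesis
      using tits_rep_trivial_mod_2_iff[OF assms X] by (simp add: sym_group_one)
  qed
  then show ?thesis
    unfolding triplet_congruence_def pure_triplet_group_def kernel_def by blast
qed

end
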